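(* Let $\sum_{n=1}^\infty x_n$ be a conditionally convergent series in $\mathbb{R}^2$ which has more than two Levy vectors. Then $\mathrm{A}_{\mathrm{abs}}(x_n)=\mathbb{R}^2$.
   Context: A series $\sum_{n=1}^\infty x_n$ in $\mathbb{R}^2$ is conditionally convergent if it converges but $\sum_{n=1}^\infty\Vert x_n\Vert=\infty$. A vector $u\in\mathbb{R}^2$ with $\Vert u\Vert=1$ is a Levy vector of $\sum_{n=1}^\infty x_n$ if for every $\varepsilon>0$ we have $\sum_{n:\,x_n\in S_\varepsilon(u)}\Vert x_n\Vert=\infty$, where $S_\varepsilon(u)=\{v\in\mathbb{R}^2:\langle u,v\rangle\ge(1-\varepsilon)\Vert u\Vert\,\Vert v\Vert\}$. $\mathrm{A}_{\mathrm{abs}}(x_n)$ denotes the set of all sums of absolutely convergent subseries: $\mathrm{A}_{\mathrm{abs}}(x_n)=\{\sum_{n=1}^\infty\varepsilon_nx_n:\ \varepsilon_n\in\{0,1\}\text{ for each }n\in\mathbb{N},\ \sum_{n=1}^\infty\varepsilon_n\Vert x_n\Vert<\infty\}$. *)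

theory Defs
  imports "HOL-Analysis.Analysis"
begin

text \<open>Series are indexed by \<^typ>\<open>nat\<close>, hence start at \<open>0\<close>.\<close>

definition conditionally_convergent :: "(nat \<Rightarrow> 'a::real_normed_vector) \<Rightarrow> bool" where
  "conditionally_convergent x \<longleftrightarrow> summable x \<and> \<not> summable (\<lambda>n. norm (x n))"

definition sector :: "real \<Rightarrow> 'a::real_inner \<Rightarrow> 'a set" where
  "sector \<epsilon> u = {v. inner u v \<ge> (1 - \<epsilon>) * norm u * norm v}"

text \<open>For the nonnegative terms \<open>norm (x n)\<close>, a sum being infinite means failure of
  summability over the index set.\<close>

definition Levy_vector :: "(nat \<Rightarrow> 'a::real_inner) \<Rightarrow> 'a \<Rightarrow> bool" where
  "Levy_vector x u \<longleftrightarrow> norm u = 1 \<and>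
     (\<forall>\<epsilon>>0. \<not> (\<lambda>n. norm (x n)) summable_on {n. x n \<in> sector \<epsilon> u})"

definition A_abs :: "(nat \<Rightarrow> 'a::real_normed_vector) \<Rightarrow> 'a set" where
  "A_abs x = {(\<Sum>n. \<epsilon> n *\<^sub>R x n) | \<epsilon> :: nat \<Rightarrow> real.
     (\<forall>n. \<epsilon> n \<in> {0, 1}) \<and> summable (\<lambda>n. \<epsilon> n * norm (x n))}"

end

theory Submission
  imports Defs
begin

text \<open>Terms pointing almost in a Levy direction \<open>u\<close> are small and have infinite total length, so
  arbitrarily late finite subsums approximate every \<open>t *\<^sub>R u\<close> with \<open>t \<ge> 0\<close>, at a total length close
  to \<open>t\<close> (\<open>approachable_Levy_vector\<close>). Concatenating such subsums, one approximates every vector in the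
  convex cone spanned by the Levy vectors.

  This cone contains a closed half-plane. Indeed, the Levy vectors cannot all lie in an open
  half-plane: the positive parts of the terms, measured along its normal, would have an infinite sum
  and the negative parts a finite one, although the series converges. By compactness \<open>0\<close> is then a
  convex combination of Levy vectors, and solving for a vector \<open>u\<close> of positive weight shows that
  \<open>- u\<close> lies in the cone. A third Levy vector \<open>w\<close> lies off the line through \<open>u\<close>, and
  \<open>u\<close>, \<open>- u\<close>, \<open>w\<close> span the half-plane \<open>inner r e \<ge> 0\<close>, where \<open>e\<close> is the unit normal of that line on
  the side of \<open>w\<close>. The cost of approximating \<open>r\<close> there is at most a constant times \<open>norm r\<close>.

  The half-plane may be all of the cone (for instance if \<open>u\<close>, \<open>- u\<close>, \<open>w\<close> are the only Levy vectors),
  so a residual outside it cannot be approximated directly. The terms with \<open>inner (x n) e \<le> 0\<close>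
  nevertheless have divergent components along \<open>e\<close>, because those near \<open>w\<close> contribute \<open>+\<infinity>\<close> to a
  convergent series. Finitely many of them move any target \<open>p\<close> into the open half-plane. From then
  on the residual is kept near \<open>(1/2)^k *\<^sub>R e\<close>, well inside the half-plane: each correction
  costs a multiple of \<open>(1/2)^k\<close>, so the finite set of terms used at the start
  and all corrections together form an absolutely convergent subseries with sum \<open>p\<close> (\<open>A_abs_eq_UNIV_if_half_space_approachable\<close>).\<close>

section \<open>Levy vectors and half-planes\<close>

lemma sector_norm_diff_le:
  fixes u y :: "'a::real_inner"
  assumes u: "norm u = 1" and y: "y \<in> sector (\<kappa>\<^sup>2 / 2) u" and k: "0 \<le> \<kappa>"
  shows "norm (y - norm y *\<^sub>R u) \<le> \<kappa> * norm y"
proof (rule power2_le_imp_le)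
  have uu: "inner u u = 1" using u by (simp add: dot_square_norm)
  have "(norm (y - norm y *\<^sub>R u))\<^sup>2 = 2 * (norm y)\<^sup>2 - 2 * norm y * inner u y"
    by (simp add: power2_norm_eq_inner inner_diff_left inner_diff_right uu inner_commute[of y u])
       (simp add: dot_square_norm power2_eq_square right_diff_distrib)
  also have "\<dots> \<le> 2 * (norm y)\<^sup>2 - 2 * norm y * ((1 - \<kappa>\<^sup>2 / 2) * norm y)"
    using y u by (intro diff_left_mono mult_left_mono) (auto simp: sector_def)
  also have "\<dots> = (\<kappa> * norm y)\<^sup>2"
    by (simp add: power2_eq_square algebra_simps)
  finally show "(norm (y - norm y *\<^sub>R u))\<^sup>2 \<le> (\<kappa> * norm y)\<^sup>2" .
  show "0 \<le> \<kappa> * norm y" using k by simp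
qed

text \<open>The components along \<open>v\<close> form a convergent series. If their negative parts had a finite sum,
  it would converge absolutely; but a term of direction close to \<open>u\<close> has a component
  along \<open>v\<close> comparable to its length, and these lengths add up to infinity.\<close>
lemma Levy_vector_inner_not_summable_on:
  fixes x :: "nat \<Rightarrow> 'a::real_inner"
  assumes conv: "summable x" and Levy: "Levy_vector x u" and uv: "inner u v > 0"
  shows "\<not> (\<lambda>n. inner (x n) v) summable_on {n. inner (x n) v \<le> 0}"
proof
  let ?f = "\<lambda>n. inner (x n) v"
  let ?g = "\<lambda>n. if ?f n \<le> 0 then ?f n else 0"
  assume neg: "?f summable_on {n. ?f n \<le> 0}"
  have u: "norm u = 1" using Levy by (simp add: Levy_vector_def)
  have "?g summable_on UNIV"
    using neg by (subst summable_on_cong_neutral[where T = "{n. ?f n \<le> 0}" and g = ?f]) auto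
  hence "summable ?g" by (rule summable_on_imp_summable)
  moreover have "summable ?f"
    by (rule bounded_linear.summable[OF bounded_linear_inner_left conv])
  ultimately have "summable (\<lambda>n. ?f n - 2 * ?g n)"
    by (intro summable_diff summable_mult)
  moreover have "(\<lambda>n. ?f n - 2 * ?g n) = (\<lambda>n. norm \<bar>?f n\<bar>)" by auto
  ultimately have "summable (\<lambda>n. norm \<bar>?f n\<bar>)" by simp
  hence abs: "(\<lambda>n. \<bar>?f n\<bar>) summable_on UNIV" by (rule norm_summable_imp_summable_on)
  \<comment> \<open>With this \<open>\<kappa>\<close>, the deviation from the direction \<open>u\<close> costs at most half of
    the component \<open>inner u v\<close> per unit of length.\<close>
  define \<kappa> where "\<kappa> = inner u v / (2 * norm v)"
  have v: "norm v > 0" using uv by auto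
  have k: "\<kappa> > 0" using uv v by (simp add: \<kappa>_def)
  let ?I = "{n. x n \<in> sector (\<kappa>\<^sup>2 / 2) u}"
  have bound: "norm (x n) \<le> 2 / inner u v * \<bar>?f n\<bar>" if n: "n \<in> ?I" for n
  proof -
    have "norm (x n) * inner u v - ?f n = inner (norm (x n) *\<^sub>R u - x n) v"
      by (simp add: inner_diff_left)
    also have "\<dots> \<le> norm (norm (x n) *\<^sub>R u - x n) * norm v" by (rule norm_cauchy_schwarz)
    also have "\<dots> \<le> \<kappa> * norm (x n) * norm v"
      using sector_norm_diff_le[OF u, of "x n" \<kappa>] n k
      by (intro mult_right_mono) (auto simp: norm_minus_commute)
    also have "\<dots> = norm (x n) * inner u v / 2" using v by (simp add: \<kappa>_def)
    finally have "norm (x n) * inner u v \<le> 2 * \<bar>?f n\<bar>" by linarith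
    thus ?thesis using uv by (simp add: field_simps)
  qed
  have "(\<lambda>n. 2 / inner u v * \<bar>?f n\<bar>) summable_on ?I"
    by (intro summable_on_cmult_right summable_on_subset_banach[OF abs]) auto
  hence "(\<lambda>n. norm (x n)) summable_on ?I"
    by (rule summable_on_comparison_test) (use bound in auto)
  thus False using Levy k by (auto simp: Levy_vector_def)
qed

text \<open>A sector around a direction contains narrower sectors around all nearby directions, so failing
  to be a Levy vector is an open condition on the unit sphere.\<close>
lemma compact_Levy_vectors:
  fixes x :: "nat \<Rightarrow> 'a::euclidean_space"
  shows "compact {u. Levy_vector x u}"
proof -
  let ?L = "{u. Levy_vector x u}"
  have "closed ?L"
    unfolding closed_sequential_limits
  proof (intro allI impI, elim conjE)
    fix a l assume a: "\<forall>n::nat. a n \<in> ?L" and lim: "a \<longlonglongrightarrow> l"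
    have na: "norm (a n) = 1" for n using a by (auto simp: Levy_vector_def)
    have "(\<lambda>n. norm (a n)) \<longlonglongrightarrow> norm l" using lim by (rule tendsto_norm)
    hence l: "norm l = 1" using na by (simp add: LIMSEQ_const_iff)
    have "\<not> (\<lambda>n. norm (x n)) summable_on {n. x n \<in> sector \<epsilon> l}" if e: "\<epsilon> > 0" for \<epsilon>
    proof
      assume s: "(\<lambda>n. norm (x n)) summable_on {n. x n \<in> sector \<epsilon> l}"
      obtain m where m: "dist (a m) l < \<epsilon> / 2"
        using lim e by (meson half_gt_zero LIMSEQ_iff_nz lim_sequentially order_refl)
      have "sector (\<epsilon> / 2) (a m) \<subseteq> sector \<epsilon> l"
      proof
        fix y assume y: "y \<in> sector (\<epsilon> / 2) (a m)"
        have "inner (a m) y - inner l y = inner (a m - l) y" by (simp add: inner_diff_left)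
        also have "\<dots> \<le> norm (a m - l) * norm y" by (rule norm_cauchy_schwarz)
        also have "\<dots> \<le> \<epsilon> / 2 * norm y"
          using m by (intro mult_right_mono) (auto simp: dist_norm)
        finally show "y \<in> sector \<epsilon> l" using y l na by (simp add: sector_def algebra_simps)
      qed
      hence "(\<lambda>n. norm (x n)) summable_on {n. x n \<in> sector (\<epsilon> / 2) (a m)}"
        by (intro summable_on_subset_banach[OF s]) auto
      moreover have "Levy_vector x (a m)" using a by auto
      ultimately show False using e unfolding Levy_vector_def by (meson half_gt_zero)
    qed
    thus "l \<in> ?L" using l by (auto simp: Levy_vector_def)
  qed
  moreover have "bounded ?L" by (intro boundedI[where B = 1]) (auto simp: Levy_vector_def)
  ultimately show ?thesis by (simp add: compact_eq_bounded_closed)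
qed

text \<open>Otherwise no direction in the compact set of unit vectors with \<open>inner w v \<le> 0\<close> is a
  Levy vector. Finitely many sectors of finite total length cover it, so the terms in that half-space
  are absolutely summable, against \<open>Levy_vector_inner_not_summable_on\<close>.\<close>
lemma Levy_vectors_not_in_open_half_space:
  fixes x :: "nat \<Rightarrow> 'a::euclidean_space"
  assumes conv: "summable x" and u: "Levy_vector x u"
  shows "\<exists>w. Levy_vector x w \<and> inner w v \<le> 0"
proof (rule ccontr)
  assume "\<not> ?thesis"
  hence pos: "\<And>w. Levy_vector x w \<Longrightarrow> inner w v > 0" by force
  define Q where "Q = sphere 0 1 \<inter> {d. inner v d \<le> 0}"
  have "compact Q" unfolding Q_def
    by (intro compact_Int_closed compact_sphere closed_halfspace_le)
  have "\<exists>\<epsilon>>0. (\<lambda>n. norm (x n)) summable_on {n. x n \<in> sector \<epsilon> d}" if "d \<in> Q" for d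
    using that pos[of d] by (auto simp: Q_def Levy_vector_def inner_commute)
  then obtain e where e: "\<And>d. d \<in> Q \<Longrightarrow> e d > 0"
    "\<And>d. d \<in> Q \<Longrightarrow> (\<lambda>n. norm (x n)) summable_on {n. x n \<in> sector (e d) d}" by metis
  obtain D where D: "D \<subseteq> Q" "finite D" "Q \<subseteq> (\<Union>d\<in>D. {y. inner d y > 1 - e d})"
  proof (rule compactE_image[OF \<open>compact Q\<close>, of Q "\<lambda>d. {y. inner d y > 1 - e d}"])
    show "Q \<subseteq> (\<Union>d\<in>Q. {y. inner d y > 1 - e d})"
      using e(1) by (force simp: Q_def dot_square_norm)
  qed (auto simp: open_halfspace_gt)
  let ?Z = "{n. x n = 0}"
  let ?B = "?Z \<union> (\<Union>d\<in>D. {n. x n \<in> sector (e d) d})"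
  have "(\<lambda>n. norm (x n)) summable_on (\<Union>d\<in>D. {n. x n \<in> sector (e d) d})"
    using \<open>finite D\<close> D(1)
  proof (induction D rule: finite_induct)
    case (insert d D)
    thus ?case using e(2)[of d] by (auto intro!: summable_on_union)
  qed auto
  moreover have "(\<lambda>n. norm (x n)) summable_on ?Z"
    by (subst summable_on_cong[where g = "\<lambda>_. 0"]) auto
  ultimately have sB: "(\<lambda>n. norm (x n)) summable_on ?B" by (intro summable_on_union)
  have "{n. inner (x n) v \<le> 0} \<subseteq> ?B"
  proof
    fix n assume n: "n \<in> {n. inner (x n) v \<le> 0}"
    show "n \<in> ?B"
    proof (cases "x n = 0")
      case False
      hence "x n /\<^sub>R norm (x n) \<in> Q"
        using n by (simp add: Q_def inner_commute mult_nonneg_nonpos)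
      then obtain d where d: "d \<in> D" "inner d (x n /\<^sub>R norm (x n)) > 1 - e d" using D(3) by auto
      have "norm d = 1" using d(1) D(1) by (auto simp: Q_def)
      hence "x n \<in> sector (e d) d" using d(2) False by (simp add: sector_def field_simps)
      thus ?thesis using d(1) by auto
    qed auto
  qed
  hence "(\<lambda>n. norm (x n)) summable_on {n. inner (x n) v \<le> 0}"
    by (rule summable_on_subset_banach[OF sB])
  hence "(\<lambda>n. norm v * norm (x n)) summable_on {n. inner (x n) v \<le> 0}"
    by (rule summable_on_cmult_right)
  moreover have "norm (inner (x n) v) \<le> norm v * norm (x n)" for n
    using Cauchy_Schwarz_ineq2[of "x n" v] by (simp add: mult.commute)
  ultimately have "(\<lambda>n. norm (inner (x n) v)) summable_on {n. inner (x n) v \<le> 0}"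
    by (rule summable_on_comparison_test) auto
  hence "(\<lambda>n. inner (x n) v) summable_on {n. inner (x n) v \<le> 0}"
    by (rule abs_summable_summable)
  thus False using Levy_vector_inner_not_summable_on[OF conv u pos[OF u]] by simp
qed

lemma zero_in_convex_hull_Levy_vectors:
  fixes x :: "nat \<Rightarrow> 'a::euclidean_space"
  assumes conv: "summable x" and u: "Levy_vector x u"
  shows "0 \<in> convex hull {u. Levy_vector x u}"
proof (rule ccontr)
  assume "0 \<notin> convex hull {u. Levy_vector x u}"
  moreover have "closed (convex hull {u. Levy_vector x u})"
    by (intro compact_imp_closed compact_convex_hull compact_Levy_vectors)
  ultimately obtain v b where "0 < b" "\<forall>y\<in>convex hull {u. Levy_vector x u}. inner v y > b"
    using separating_hyperplane_closed_0[OF convex_convex_hull] by metis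
  moreover obtain w where "Levy_vector x w" "inner w v \<le> 0"
    using Levy_vectors_not_in_open_half_space[OF conv u] by blast
  ultimately show False
    by (metis hull_inc inner_commute mem_Collect_eq not_less order.strict_trans2 less_imp_le)
qed

section \<open>Vectors approximated by late finite subsums\<close>

text \<open>The number \<open>c\<close> bounds the total length spent on the approximation. The subsums have to
  occur beyond every \<open>N\<close> so that successive approximations can use disjoint index sets.\<close>
definition approachable :: "(nat \<Rightarrow> 'a::real_normed_vector) \<Rightarrow> 'a \<Rightarrow> real \<Rightarrow> bool" where
  "approachable x d c \<longleftrightarrow> (\<forall>N. \<forall>\<delta>>0. \<exists>F. finite F \<and> F \<subseteq> {N..} \<and>
     norm (sum x F - d) < \<delta> \<and> (\<Sum>n\<in>F. norm (x n)) < c + \<delta>)"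

lemma approachable_zero: "approachable x 0 0"
  unfolding approachable_def by (auto intro!: exI[of _ "{}"])

lemma approachable_mono:
  assumes "approachable x d c" and "c \<le> c'"
  shows "approachable x d c'"
  using assms unfolding approachable_def by (meson add_right_mono order.strict_trans2)

lemma approachable_add:
  assumes "approachable x d c" and "approachable x d' c'"
  shows "approachable x (d + d') (c + c')"
  unfolding approachable_def
proof (intro allI impI)
  fix N :: nat and \<delta> :: real assume "\<delta> > 0"
  hence d: "\<delta> / 2 > 0" by simp
  obtain F where F: "finite F" "F \<subseteq> {N..}" "norm (sum x F - d) < \<delta> / 2"
    "(\<Sum>n\<in>F. norm (x n)) < c + \<delta> / 2"
    using assms(1) d unfolding approachable_def by metis
  obtain M where M: "F \<subseteq> {..<M}" using F(1) finite_nat_iff_bounded by auto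
  obtain G where G: "finite G" "G \<subseteq> {max M N..}" "norm (sum x G - d') < \<delta> / 2"
    "(\<Sum>n\<in>G. norm (x n)) < c' + \<delta> / 2"
    using assms(2) d unfolding approachable_def by metis
  have disj: "F \<inter> G = {}" using M G(2) by force
  have "norm (sum x (F \<union> G) - (d + d')) = norm ((sum x F - d) + (sum x G - d'))"
    using F(1) G(1) disj by (simp add: sum.union_disjoint algebra_simps)
  also have "\<dots> < \<delta>" using norm_triangle_ineq[of "sum x F - d" "sum x G - d'"] F(3) G(3) by linarith
  finally have "norm (sum x (F \<union> G) - (d + d')) < \<delta>" .
  moreover have "(\<Sum>n\<in>F \<union> G. norm (x n)) < c + c' + \<delta>"
    using F(1,4) G(1,4) disj by (simp add: sum.union_disjoint)
  ultimately show "\<exists>F. finite F \<and> F \<subseteq> {N..} \<and> norm (sum x F - (d + d')) < \<delta> \<and>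
      (\<Sum>n\<in>F. norm (x n)) < c + c' + \<delta>"
    using F(1,2) G(1,2) by (intro exI[of _ "F \<union> G"]) auto
qed

lemma approachable_sum:
  assumes "finite S" and "\<And>s. s \<in> S \<Longrightarrow> approachable x (d s) (c s)"
  shows "approachable x (sum d S) (sum c S)"
  using assms by (induction S rule: finite_induct) (auto intro: approachable_zero approachable_add)

text \<open>Adding small elements one at a time cannot jump over an interval longer than each of them.\<close>
lemma subset_sum_in_short_interval:
  fixes g :: "'a \<Rightarrow> real"
  assumes "finite G" and "t \<le> sum g G" and "\<And>i. i \<in> G \<Longrightarrow> g i < \<eta>" and "0 \<le> t" and "0 < \<eta>"
  shows "\<exists>F\<subseteq>G. t \<le> sum g F \<and> sum g F < t + \<eta>"
  using assms(1-3)
proof (induction G rule: finite_induct)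
  case empty
  thus ?case using assms(4,5) by auto
next
  case (insert a G)
  show ?case
  proof (cases "t \<le> sum g G")
    case True
    thus ?thesis using insert by (meson insertCI subset_insertI2)
  next
    case False
    thus ?thesis using insert.prems insert.hyps
      by (intro exI[of _ "insert a G"]) (auto simp: add.commute intro: add_strict_mono)
  qed
qed

text \<open>Late terms in a thin sector around \<open>u\<close> are short, so that some finite set of them has a total
  length just above \<open>t\<close>; as all of them nearly point along \<open>u\<close>, their sum is nearly
  \<open>t *\<^sub>R u\<close>.\<close>
lemma approachable_Levy_vector:
  fixes x :: "nat \<Rightarrow> 'a::real_inner"
  assumes lim: "x \<longlonglongrightarrow> 0" and Levy: "Levy_vector x u" and t: "0 \<le> t"
  shows "approachable x (t *\<^sub>R u) t"
  unfolding approachable_def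
proof (intro allI impI)
  fix N :: nat and \<delta> :: real assume d: "\<delta> > 0"
  have u: "norm u = 1" using Levy by (simp add: Levy_vector_def)
  \<comment> \<open>Vectors in the sector of parameter \<open>\<kappa>\<^sup>2 / 2\<close> with total length at most \<open>t + \<delta>\<close> have a total
    deviation from the direction \<open>u\<close> of at most \<open>\<delta> / 2\<close>.\<close>
  define \<kappa> where "\<kappa> = \<delta> / 2 / (t + \<delta>)"
  have k: "\<kappa> > 0" using d t by (simp add: \<kappa>_def)
  obtain M where M: "\<And>n. n \<ge> M \<Longrightarrow> norm (x n) < \<delta> / 2"
    using lim d by (metis LIMSEQ_iff diff_zero half_gt_zero)
  define I where "I = {n. x n \<in> sector (\<kappa>\<^sup>2 / 2) u}"
  define J where "J = I - {..<max M N}"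
  have nI: "\<not> (\<lambda>n. norm (x n)) summable_on I" using Levy k by (auto simp: Levy_vector_def I_def)
  have nJ: "\<not> (\<lambda>n. norm (x n)) summable_on J"
  proof
    assume "(\<lambda>n. norm (x n)) summable_on J"
    hence "(\<lambda>n. norm (x n)) summable_on (J \<union> {..<max M N})"
      by (intro summable_on_union) auto
    hence "(\<lambda>n. norm (x n)) summable_on I" by (rule summable_on_subset_banach) (auto simp: J_def)
    thus False using nI by simp
  qed
  have "\<exists>G. finite G \<and> G \<subseteq> J \<and> t \<le> (\<Sum>n\<in>G. norm (x n))"
  proof (rule ccontr)
    assume *: "\<not> ?thesis"
    have "(\<lambda>n. norm (x n)) summable_on J"
      by (rule nonneg_bdd_above_summable_on)
         (use * in \<open>auto intro!: bdd_aboveI[where M = t] simp: not_le less_imp_le\<close>)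
    thus False using nJ by simp
  qed
  then obtain G where G: "finite G" "G \<subseteq> J" "t \<le> (\<Sum>n\<in>G. norm (x n))" by blast
  have "norm (x n) < \<delta> / 2" if "n \<in> G" for n
    using that G(2) by (intro M) (auto simp: J_def)
  hence "\<exists>F\<subseteq>G. t \<le> (\<Sum>n\<in>F. norm (x n)) \<and> (\<Sum>n\<in>F. norm (x n)) < t + \<delta> / 2"
    using G t d by (intro subset_sum_in_short_interval) auto
  then obtain F where F: "F \<subseteq> G" "t \<le> (\<Sum>n\<in>F. norm (x n))" "(\<Sum>n\<in>F. norm (x n)) < t + \<delta> / 2"
    by blast
  let ?s = "\<Sum>n\<in>F. norm (x n)"
  have "norm (sum x F - ?s *\<^sub>R u) = norm (\<Sum>n\<in>F. x n - norm (x n) *\<^sub>R u)"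
    by (simp add: sum_subtractf scaleR_left.sum)
  also have "\<dots> \<le> (\<Sum>n\<in>F. \<kappa> * norm (x n))"
    by (rule sum_norm_le, rule sector_norm_diff_le[OF u])
       (use F G k in \<open>auto simp: J_def I_def\<close>)
  also have "\<dots> = \<kappa> * ?s" by (simp add: sum_distrib_left)
  also have "\<dots> \<le> \<kappa> * (t + \<delta>)" using F(3) k d by (intro mult_left_mono) auto
  also have "\<dots> = \<delta> / 2"
    by (rule iffD1[OF nonzero_eq_divide_eq \<kappa>_def]) (use t d in simp)
  finally have 1: "norm (sum x F - ?s *\<^sub>R u) \<le> \<delta> / 2" .
  have 2: "norm (?s *\<^sub>R u - t *\<^sub>R u) < \<delta> / 2"
    using F u by (simp flip: scaleR_diff_left)
  have "norm (sum x F - t *\<^sub>R u) < \<delta>"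
    using norm_triangle_ineq[of "sum x F - ?s *\<^sub>R u" "?s *\<^sub>R u - t *\<^sub>R u"] 1 2 by simp
  moreover have "F \<subseteq> {N..}" using F(1) G(2) by (auto simp: J_def)
  moreover have "finite F" using F(1) G(1) by (rule finite_subset)
  ultimately show "\<exists>F. finite F \<and> F \<subseteq> {N..} \<and> norm (sum x F - t *\<^sub>R u) < \<delta> \<and>
      (\<Sum>n\<in>F. norm (x n)) < t + \<delta>"
    using F(3) d by (intro exI[of _ F]) auto
qed

text \<open>From \<open>0 = (\<Sum>s\<in>S. c s *\<^sub>R s)\<close> with Levy vectors \<open>s\<close>, every \<open>u\<close> with \<open>c u > 0\<close> satisfies
  \<open>- u = (\<Sum>s\<in>S - {u}. (c s / c u) *\<^sub>R s)\<close>, a nonnegative combination.\<close>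
lemma Levy_vector_with_approachable_opposite:
  fixes x :: "nat \<Rightarrow> 'a::euclidean_space"
  assumes conv: "summable x" and ne: "Levy_vector x v"
  shows "\<exists>u C. Levy_vector x u \<and> 0 \<le> C \<and> (\<forall>t\<ge>0. approachable x (- (t *\<^sub>R u)) (C * t))"
proof -
  obtain S c where S: "finite S" "S \<subseteq> {u. Levy_vector x u}" "\<And>s. s \<in> S \<Longrightarrow> 0 \<le> (c s :: real)"
    "sum c S = 1" "(\<Sum>s\<in>S. c s *\<^sub>R s) = 0"
    using zero_in_convex_hull_Levy_vectors[OF conv ne] unfolding convex_hull_explicit by auto
  obtain u where u: "u \<in> S" "c u > 0"
    using S(3,4) by (metis less_eq_real_def sum.neutral zero_neq_one)
  define C where "C = (\<Sum>s\<in>S - {u}. c s / c u)"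
  have C: "0 \<le> C" unfolding C_def using S(3) u by (intro sum_nonneg) auto
  have "approachable x (- (t *\<^sub>R u)) (C * t)" if t: "0 \<le> t" for t
  proof -
    have "approachable x (\<Sum>s\<in>S - {u}. (t * c s / c u) *\<^sub>R s) (\<Sum>s\<in>S - {u}. t * c s / c u)"
      by (rule approachable_sum, use S in simp, rule approachable_Levy_vector)
         (use S u t summable_LIMSEQ_zero[OF conv] in auto)
    moreover have "(\<Sum>s\<in>S - {u}. (t * c s / c u) *\<^sub>R s) = (t / c u) *\<^sub>R (\<Sum>s\<in>S - {u}. c s *\<^sub>R s)"
      by (simp add: scaleR_sum_right)
    moreover have "(\<Sum>s\<in>S - {u}. c s *\<^sub>R s) = - (c u *\<^sub>R u)"
      using S(1,5) u by (simp add: sum_diff1)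
    moreover have "(\<Sum>s\<in>S - {u}. t * c s / c u) = C * t"
      by (simp add: C_def sum_distrib_left mult.commute[of _ t])
    ultimately show ?thesis using u by simp
  qed
  thus ?thesis using S(2) u(1) C by blast
qed

section \<open>Exact sums from approximations\<close>

text \<open>The union of the sets \<open>G k\<close> is the index set of the subseries. Summable costs make the
  subseries absolutely convergent, hence unconditionally, and so its sum can be computed along the
  exhaustion \<open>G\<close> instead of along initial segments of the indices.\<close>
lemma A_abs_memI:
  fixes x :: "nat \<Rightarrow> 'a::banach"
  assumes fin: "\<And>k. finite (G k)" and inc: "\<And>k. G k \<subseteq> G (Suc k)"
    and cost: "\<And>k. (\<Sum>n\<in>G (Suc k) - G k. norm (x n)) \<le> b k" and b: "summable b"
    and lim: "(\<lambda>k. sum x (G k)) \<longlonglongrightarrow> p"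
  shows "p \<in> A_abs x"
proof -
  have mono: "incseq G" using inc by (rule incseq_SucI)
  define U where "U = (\<Union>k. G k)"
  define \<epsilon> :: "nat \<Rightarrow> real" where "\<epsilon> = indicator U"
  have b0: "0 \<le> b k" for k using cost[of k] by (meson order_trans sum_nonneg norm_ge_zero)
  have bound: "(\<Sum>n\<in>G k. norm (x n)) \<le> (\<Sum>n\<in>G 0. norm (x n)) + sum b {..<k}" for k
  proof (induction k)
    case (Suc k)
    have "(\<Sum>n\<in>G (Suc k). norm (x n)) = (\<Sum>n\<in>G (Suc k) - G k. norm (x n)) + (\<Sum>n\<in>G k. norm (x n))"
      using fin inc by (metis sum.subset_diff)
    thus ?case using Suc cost[of k] by simp
  qed simp
  have absorb: "\<exists>k. F \<subseteq> G k" if "finite F" "F \<subseteq> U" for F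
    using that
  proof (induction F rule: finite_induct)
    case (insert a F)
    then obtain k l where "F \<subseteq> G k" "a \<in> G l" by (auto simp: U_def)
    moreover have "G k \<subseteq> G (max k l)" "G l \<subseteq> G (max k l)"
      using mono by (simp_all add: incseq_def)
    ultimately show ?case by (intro exI[of _ "max k l"]) auto
  qed auto
  have "(\<lambda>n. norm (x n)) summable_on U"
  proof (rule nonneg_bdd_above_summable_on)
    show "bdd_above (sum (\<lambda>n. norm (x n)) ` {F. F \<subseteq> U \<and> finite F})"
    proof (rule bdd_aboveI2)
      fix F assume "F \<in> {F. F \<subseteq> U \<and> finite F}"
      then obtain k where "F \<subseteq> G k" using absorb by blast
      hence "(\<Sum>n\<in>F. norm (x n)) \<le> (\<Sum>n\<in>G k. norm (x n))" by (intro sum_mono2 fin) auto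
      also have "\<dots> \<le> (\<Sum>n\<in>G 0. norm (x n)) + suminf b"
        using bound[of k] sum_le_suminf[OF b, of "{..<k}"] b0 by auto
      finally show "(\<Sum>n\<in>F. norm (x n)) \<le> (\<Sum>n\<in>G 0. norm (x n)) + suminf b" .
    qed
  qed simp
  hence abs: "(\<lambda>n. norm (x n)) summable_on U" .
  have absorb_ev: "filterlim G (finite_subsets_at_top U) sequentially"
    unfolding filterlim_finite_subsets_at_top
  proof (intro allI impI, elim conjE)
    fix F assume "finite F" "F \<subseteq> U"
    then obtain k where k: "F \<subseteq> G k" using absorb by blast
    show "\<forall>\<^sub>F k in sequentially. finite (G k) \<and> F \<subseteq> G k \<and> G k \<subseteq> U"
      using eventually_ge_at_top[of k]
    proof eventually_elim
      case (elim l)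
      thus ?case using k mono fin by (auto simp: incseq_def U_def)
    qed
  qed
  have "(x has_sum infsum x U) U" using abs by (simp add: abs_summable_summable)
  hence "(\<lambda>k. sum x (G k)) \<longlonglongrightarrow> infsum x U"
    unfolding has_sum_def by (rule filterlim_compose[OF _ absorb_ev])
  hence p: "infsum x U = p" using lim by (rule LIMSEQ_unique)
  have "(x has_sum p) U" using abs p abs_summable_summable has_sum_infsum by blast
  hence "((\<lambda>n. \<epsilon> n *\<^sub>R x n) has_sum p) UNIV"
    by (subst has_sum_cong_neutral[where T = U and g = x]) (auto simp: \<epsilon>_def)
  hence "(\<lambda>n. \<epsilon> n *\<^sub>R x n) sums p" by (rule has_sum_imp_sums)
  moreover have "(\<lambda>n. \<epsilon> n * norm (x n)) summable_on UNIV"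
    using abs by (subst summable_on_cong_neutral[where T = U and g = "\<lambda>n. norm (x n)"]) (auto simp: \<epsilon>_def)
  hence "summable (\<lambda>n. \<epsilon> n * norm (x n))" by (rule summable_on_imp_summable)
  moreover have "\<forall>n. \<epsilon> n \<in> {0, 1}" by (auto simp: \<epsilon>_def indicator_def)
  ultimately show ?thesis unfolding A_abs_def by (auto simp: sums_iff)
qed

text \<open>The hypothesis offers approximation only in a half-space, so every correction must leave a
  residual inside it. This is why a correction does not aim at the whole residual \<open>r\<close> but at
  \<open>r - s *\<^sub>R e\<close> with \<open>0 < s \<le> inner r e\<close>: an error below \<open>s / 4\<close> then keeps the new residual
  within \<open>s / 4\<close> of \<open>s *\<^sub>R e\<close>, and the next correction can use \<open>s / 2\<close>.\<close>
lemma A_abs_eq_UNIV_if_half_space_approachable: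
  fixes x :: "nat \<Rightarrow> 'a::euclidean_space"
  assumes conv: "summable x" and e: "norm e = 1"
    and w: "Levy_vector x w" "inner w e > 0"
    and app: "\<And>r. inner r e \<ge> 0 \<Longrightarrow> approachable x r (K * norm r)" and K: "0 \<le> K"
  shows "A_abs x = UNIV"
proof -
  have "p \<in> A_abs x" for p
  proof -
    have ee: "inner e e = 1" using e by (simp add: dot_square_norm)
    have step: "\<exists>F. finite F \<and> G \<inter> F = {} \<and> norm (p - sum x (G \<union> F) - s *\<^sub>R e) \<le> s / 4 \<and>
        (\<Sum>n\<in>F. norm (x n)) \<le> K * norm (p - sum x G - s *\<^sub>R e) + s / 4"
      if G: "finite G" and s: "0 < s" "s \<le> inner (p - sum x G) e" for G s
    proof -
      let ?d = "p - sum x G - s *\<^sub>R e"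
      obtain N where N: "G \<subseteq> {..<N}" using G finite_nat_iff_bounded by auto
      have "inner ?d e \<ge> 0" using s ee by (simp add: inner_diff_left)
      then obtain F where F: "finite F" "F \<subseteq> {N..}" "norm (sum x F - ?d) < s / 4"
        "(\<Sum>n\<in>F. norm (x n)) < K * norm ?d + s / 4"
        using app s(1) unfolding approachable_def by (meson divide_pos_pos zero_less_numeral)
      have disj: "G \<inter> F = {}" using N F(2) by force
      have "p - sum x (G \<union> F) - s *\<^sub>R e = - (sum x F - ?d)"
        using G F(1) disj by (simp add: sum.union_disjoint)
      hence "norm (p - sum x (G \<union> F) - s *\<^sub>R e) \<le> s / 4"
        using F(3) by (metis norm_minus_cancel less_imp_le)
      thus ?thesis using F(1,4) disj by (intro exI[of _ F]) auto
    qed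
    \<comment> \<open>Terms pointing away from \<open>e\<close> bring the residual into the half-space; here their lengths are
      uncontrolled, which is harmless as this happens once.\<close>
    let ?Q = "{n. inner (x n) e \<le> 0}"
    have "\<exists>F. finite F \<and> F \<subseteq> ?Q \<and> 1 - inner p e \<le> (\<Sum>n\<in>F. - inner (x n) e)"
    proof (rule ccontr)
      assume *: "\<not> ?thesis"
      have "(\<lambda>n. - inner (x n) e) summable_on ?Q"
        by (rule nonneg_bdd_above_summable_on)
           (use * in \<open>auto intro!: bdd_aboveI[where M = "1 - inner p e"] simp: not_le less_imp_le\<close>)
      thus False using Levy_vector_inner_not_summable_on[OF conv w]
        by (simp add: summable_on_uminus)
    qed
    then obtain F0 where F0: "finite F0" "1 - inner p e \<le> (\<Sum>n\<in>F0. - inner (x n) e)" by blast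
    have "1 \<le> inner (p - sum x F0) e"
      using F0(2) by (simp add: inner_diff_left inner_sum_left sum_negf)
    then obtain F1 where F1: "finite F1" "norm (p - sum x (F0 \<union> F1) - 1 *\<^sub>R e) \<le> 1 / 4"
      using step[OF F0(1), of 1] by auto
    define P where "P = (\<lambda>k G. finite G \<and> norm (p - sum x G - (1/2)^k *\<^sub>R e) \<le> (1/2)^k / 4)"
    define b :: "nat \<Rightarrow> real" where "b = (\<lambda>k. (K + 1) * (1/2)^k)"
    have "\<exists>G. \<forall>k. P k (G k) \<and> (G k \<subseteq> G (Suc k) \<and> (\<Sum>n\<in>G (Suc k) - G k. norm (x n)) \<le> b k)"
    proof (rule dependent_nat_choice)
      show "\<exists>G. P 0 G" using F0(1) F1 by (intro exI[of _ "F0 \<union> F1"]) (auto simp: P_def)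
    next
      fix G k assume P: "P k G"
      define s :: real where "s = (1/2)^k"
      define r where "r = p - sum x G"
      have s: "s > 0" by (simp add: s_def)
      have r: "norm (r - s *\<^sub>R e) \<le> s / 4" using P by (simp add: P_def r_def s_def)
      have "inner (s *\<^sub>R e - r) e \<le> norm (s *\<^sub>R e - r) * norm e" by (rule norm_cauchy_schwarz)
      hence "s / 2 \<le> inner r e"
        using r e ee s by (simp add: inner_diff_left norm_minus_commute)
      then obtain F where F: "finite F" "G \<inter> F = {}" "norm (p - sum x (G \<union> F) - (s/2) *\<^sub>R e) \<le> s / 2 / 4"
        "(\<Sum>n\<in>F. norm (x n)) \<le> K * norm (r - (s/2) *\<^sub>R e) + s / 2 / 4"
        using step[of G "s/2"] P s unfolding P_def r_def by auto
      have "r - (s/2) *\<^sub>R e = (r - s *\<^sub>R e) + (s/2) *\<^sub>R e"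
        by (simp add: algebra_simps flip: scaleR_add_left)
      hence "norm (r - (s/2) *\<^sub>R e) \<le> norm (r - s *\<^sub>R e) + norm ((s/2) *\<^sub>R e)"
        by (metis norm_triangle_ineq)
      also have "\<dots> \<le> s" using r e s by simp
      finally have "K * norm (r - (s/2) *\<^sub>R e) \<le> K * s" using K by (rule mult_left_mono)
      hence "(\<Sum>n\<in>F. norm (x n)) \<le> K * s + s" using F(4) s by linarith
      hence "(\<Sum>n\<in>F. norm (x n)) \<le> b k" by (simp add: b_def s_def algebra_simps)
      moreover have "G \<union> F - G = F" using F(2) by auto
      moreover have "P (Suc k) (G \<union> F)" using F P by (simp add: P_def s_def)
      ultimately show "\<exists>H. P (Suc k) H \<and> G \<subseteq> H \<and> (\<Sum>n\<in>H - G. norm (x n)) \<le> b k"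
        by (intro exI[of _ "G \<union> F"]) auto
    qed
    then obtain G where G: "\<And>k. P k (G k)" "\<And>k. G k \<subseteq> G (Suc k)"
      "\<And>k. (\<Sum>n\<in>G (Suc k) - G k. norm (x n)) \<le> b k" by blast
    have half: "(\<lambda>k. (1/2::real)^k) \<longlonglongrightarrow> 0" by (simp add: LIMSEQ_power_zero)
    have "(\<lambda>k. p - sum x (G k) - (1/2)^k *\<^sub>R e) \<longlonglongrightarrow> 0"
    proof (rule Lim_null_comparison)
      show "\<forall>\<^sub>F k in sequentially. norm (p - sum x (G k) - (1/2)^k *\<^sub>R e) \<le> (1/2)^k / 4"
        using G(1) by (simp add: P_def)
      show "(\<lambda>k. (1/2::real)^k / 4) \<longlonglongrightarrow> 0" using tendsto_divide[OF half tendsto_const[of 4]] by simp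
    qed
    moreover have "(\<lambda>k. (1/2::real)^k *\<^sub>R e) \<longlonglongrightarrow> 0"
      using tendsto_scaleR[OF half tendsto_const[of e]] by simp
    ultimately have "(\<lambda>k. p - ((p - sum x (G k) - (1/2)^k *\<^sub>R e) + (1/2)^k *\<^sub>R e)) \<longlonglongrightarrow> p - (0 + 0)"
      by (intro tendsto_intros)
    hence "(\<lambda>k. sum x (G k)) \<longlonglongrightarrow> p" by simp
    moreover have "summable b" unfolding b_def by (intro summable_mult summable_geometric) simp
    ultimately show "p \<in> A_abs x" using G by (intro A_abs_memI[of G x b]) (auto simp: P_def)
  qed
  thus ?thesis by auto
qed

section \<open>The planar case\<close>

text \<open>Rotating \<open>u\<close> by a right angle gives the second basis vector.\<close>
lemma ex_orthonormal_basis_plane: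
  fixes u :: "real ^ 2"
  assumes u: "norm u = 1"
  shows "\<exists>e. norm e = 1 \<and> (\<forall>r. r = inner r u *\<^sub>R u + inner r e *\<^sub>R e)"
proof -
  define e :: "real ^ 2" where "e = vector [- u$2, u$1]"
  have uu: "u$1 * u$1 + u$2 * u$2 = 1"
    using u by (simp add: norm_eq_1 inner_vec_def sum_2)
  have "norm e = 1" using uu by (simp add: norm_eq_1 inner_vec_def sum_2 e_def vector_2)
  moreover have "r = inner r u *\<^sub>R u + inner r e *\<^sub>R e" for r
  proof -
    have "r$1 = r$1 * (u$1 * u$1 + u$2 * u$2)" "r$2 = r$2 * (u$1 * u$1 + u$2 * u$2)" using uu by auto
    thus ?thesis
      by (simp add: vec_eq_iff forall_2 inner_vec_def sum_2 e_def vector_2 algebra_simps)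
  qed
  ultimately show ?thesis by blast
qed

theorem theorem2p7:
  fixes x :: "nat \<Rightarrow> real ^ 2"
  assumes "conditionally_convergent x"
    and "infinite {u. Levy_vector x u} \<or> card {u. Levy_vector x u} > 2"
  shows "A_abs x = UNIV"
proof -
  let ?L = "{u. Levy_vector x u}"
  have conv: "summable x" using assms(1) by (simp add: conditionally_convergent_def)
  have lim: "x \<longlonglongrightarrow> 0" using conv by (rule summable_LIMSEQ_zero)
  have many: "\<not> ?L \<subseteq> {a, b}" for a b
  proof
    assume sub: "?L \<subseteq> {a, b}"
    hence "finite ?L" using finite_subset by blast
    moreover have "card ?L \<le> card {a, b}" using sub by (intro card_mono) auto
    moreover have "card {a, b} \<le> 2" by (simp add: card_insert_if)
    ultimately show False using assms(2) by linarith
  qed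
  then obtain v where "Levy_vector x v" by blast
  then obtain u C where u: "Levy_vector x u" and C: "0 \<le> C"
    and opp: "\<And>t. 0 \<le> t \<Longrightarrow> approachable x (- (t *\<^sub>R u)) (C * t)"
    using Levy_vector_with_approachable_opposite[OF conv] by blast
  have nu: "norm u = 1" using u by (simp add: Levy_vector_def)
  obtain e0 where e0: "norm e0 = 1" "\<And>r. r = inner r u *\<^sub>R u + inner r e0 *\<^sub>R e0"
    using ex_orthonormal_basis_plane[OF nu] by blast
  \<comment> \<open>This is where a third Levy vector is needed.\<close>
  obtain w where w: "Levy_vector x w" "w \<noteq> u" "w \<noteq> - u" using many[of u "- u"] by blast
  have "inner w e0 \<noteq> 0"
  proof
    assume "inner w e0 = 0"
    hence *: "w = inner w u *\<^sub>R u" using e0(2)[of w] by simp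
    hence "\<bar>inner w u\<bar> = 1" using w(1) nu by (metis Levy_vector_def mult.right_neutral norm_scaleR)
    thus False using * w(2,3) by (metis abs_eq_iff' abs_1 scaleR_minus1_left scaleR_one)
  qed
  define e where "e = sgn (inner w e0) *\<^sub>R e0"
  define c where "c = inner w e"
  have c: "c > 0" using \<open>inner w e0 \<noteq> 0\<close> by (simp add: c_def e_def sgn_if)
  have e: "norm e = 1" using e0(1) \<open>inner w e0 \<noteq> 0\<close> by (simp add: e_def sgn_if)
  have dec: "r = inner r u *\<^sub>R u + inner r e *\<^sub>R e" for r
    using e0(2)[of r] \<open>inner w e0 \<noteq> 0\<close> by (simp add: e_def sgn_if)
  \<comment> \<open>In \<open>r = \<alpha> *\<^sub>R u + \<beta> *\<^sub>R w\<close> one has \<open>\<bar>\<alpha>\<bar> \<le> norm r * (1 + 1 / c)\<close> and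
    \<open>\<beta> \<le> norm r / c\<close>; the unit cost is at most \<open>C + 1\<close> along the line of \<open>u\<close> and
    \<open>1\<close> along \<open>w\<close>.\<close>
  define K where "K = (C + 1) * (1 + 1 / c) + 1 / c"
  have K: "0 \<le> K" using C c by (simp add: K_def)
  have line: "approachable x (a *\<^sub>R u) ((C + 1) * \<bar>a\<bar>)" for a
  proof (cases "0 \<le> a")
    case True
    thus ?thesis using C
      by (intro approachable_mono[OF approachable_Levy_vector[OF lim u True]])
         (simp add: algebra_simps)
  next
    case False
    thus ?thesis using approachable_mono[OF opp[of "- a"]] by (simp add: algebra_simps)
  qed
  have "approachable x r (K * norm r)" if r: "inner r e \<ge> 0" for r
  proof -
    define \<beta> where "\<beta> = inner r e / c"
    define \<alpha> where "\<alpha> = inner r u - \<beta> * inner w u"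
    have b: "0 \<le> \<beta>" using r c by (simp add: \<beta>_def)
    have "inner r e \<le> norm r" using norm_cauchy_schwarz[of r e] e by simp
    hence b': "\<beta> \<le> norm r / c" using c by (simp add: \<beta>_def divide_right_mono)
    have "\<bar>inner r u\<bar> \<le> norm r" using Cauchy_Schwarz_ineq2[of r u] nu by simp
    moreover have "\<bar>inner w u\<bar> \<le> 1"
      using Cauchy_Schwarz_ineq2[of w u] nu w(1) by (simp add: Levy_vector_def)
    hence "\<bar>\<beta> * inner w u\<bar> \<le> \<beta>" using b by (simp add: abs_mult mult_left_le)
    ultimately have a: "\<bar>\<alpha>\<bar> \<le> norm r + norm r / c" using b' unfolding \<alpha>_def by linarith
    have "r = \<alpha> *\<^sub>R u + \<beta> *\<^sub>R (inner w u *\<^sub>R u + c *\<^sub>R e)"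
      using dec[of r] c by (simp add: \<alpha>_def \<beta>_def algebra_simps)
    also have "inner w u *\<^sub>R u + c *\<^sub>R e = w" using dec[of w] by (simp add: c_def)
    finally have "r = \<alpha> *\<^sub>R u + \<beta> *\<^sub>R w" .
    moreover have "approachable x (\<alpha> *\<^sub>R u + \<beta> *\<^sub>R w) ((C + 1) * \<bar>\<alpha>\<bar> + \<beta>)"
      by (intro approachable_add line approachable_Levy_vector[OF lim w(1) b])
    moreover have "(C + 1) * \<bar>\<alpha>\<bar> + \<beta> \<le> (C + 1) * (norm r + norm r / c) + norm r / c"
      using a b' C by (intro add_mono mult_left_mono) auto
    moreover have "\<dots> = K * norm r" by (simp add: K_def algebra_simps)
    ultimately show ?thesis using approachable_mono by metis
  qed
  thus ?thesis
    using A_abs_eq_UNIV_if_half_space_approachable[OF conv e w(1)] c K unfolding c_def by blast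
qed

end
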